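(* Let $\mathcal{H}$ be a topological VE-space over a topologically ordered $*$-space $Z$, let $X$ be a nonempty set, and let $\mathbf{k}\colon X\times X\to\mathcal{L}^*(\mathcal{H})$ be a positive semidefinite kernel. Assume that for every $x\in X$ the operator $\mathbf{k}(x,x)$ is m-topologisable. Then, for any $x\in X$ and any $p\in S(Z)$, there exists a constant $c_p(x)\ge0$ such that for all $n\in\mathbb{N}$, $y_1,\dots,y_n\in X$, $h_1,\dots,h_n\in\mathcal{H}$, $$p\Bigl(\sum_{i,j=1}^n[\mathbf{k}(x,y_i)h_i,\mathbf{k}(x,y_j)h_j]\Bigr)\le c_p(x)\,p\Bigl(\sum_{i,j=1}^n[\mathbf{k}(y_j,y_i)h_i,h_j]\Bigr).$$
   Context: An ordered $*$-space is a complex vector space $Z$ with a conjugate linear involution $z\mapsto z^*$ and a cone $Z^+$ (closed under linear combinations with nonnegative coefficients) that is strict ($Z^+\cap(-Z^+)=\{0\}$) and consists of selfadjoint elements; for selfadjoint $z_1,z_2$, $z_1\ge z_2$ means $z_1-z_2\in Z^+$. A seminorm $p$ on $Z$ is increasing if $0\le x\le y$ implies $p(x)\le p(y)$. $Z$ is topologically ordered if it is also a Hausdorff locally convex space whose topology is generated by a family of absolutely convex neighbourhoods $C$ of the origin that are solid ($x\in C$, $0\le y\le x$ imply $y\in C$); equivalently, its topology is defined by a family of increasing seminorms. $S(Z)$ is the set of all continuous increasing seminorms on $Z$. A VE-space over $Z$ is a complex vector space $\mathcal{H}$ with a map (gramian) $[\cdot,\cdot]\colon\mathcal{H}\times\mathcal{H}\to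 Z$, linear in the second variable, with $[x,y]=[y,x]^*$, $[x,x]\ge0$, and $[x,x]=0$ iff $x=0$. When $Z$ is topologically ordered, $\mathcal{H}$ carries the Hausdorff locally convex topology generated by the seminorms $\tilde p(h)=p([h,h])^{1/2}$, $p\in S(Z)$, and is called a topological VE-space. $\mathcal{L}(\mathcal{H})$ is the space of all linear operators $\mathcal{H}\to\mathcal{H}$, and $\mathcal{L}^*(\mathcal{H})$ is the algebra of those $T$ that are adjointable: there is a linear $T^*$ with $[Tg,h]=[g,T^*h]$ for all $g,h$. A kernel $\mathbf{k}$ is positive semidefinite if $\sum_{i,j=1}^n[\mathbf{k}(x_i,x_j)h_j,h_i]\ge0$ for all $n\in\mathbb{N}$, $x_i\in X$, $h_i\in\mathcal{H}$. $T\in\mathcal{L}(\mathcal{H})$ is m-topologisable if for every $p\in S(Z)$ there exist a constant $D_p\ge0$ and a continuous seminorm $r$ on $\mathcal{H}$ such that $p([T^nh,T^nh])^{1/2}\le D_p^n\,r(h)$ for all $n\in\mathbb{N}$ and $h\in\mathcal{H}$. *)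

theory Defs
  imports "HOL-Analysis.Analysis"
begin

text \<open>
  Complex vector spaces are types of class \<open>ab_group_add\<close> together with an explicit scalar
  multiplication by complex numbers satisfying the library locale \<open>vector_space\<close>.  Topologies are
  values of the library type \<open>'a topology\<close>.
\<close>

definition selfadjoint :: "('z \<Rightarrow> 'z) \<Rightarrow> 'z \<Rightarrow> bool" where
  "selfadjoint star z \<longleftrightarrow> star z = z"

definition star_le :: "('z::ab_group_add \<Rightarrow> 'z) \<Rightarrow> 'z set \<Rightarrow> 'z \<Rightarrow> 'z \<Rightarrow> bool" where
  "star_le star pos z\<^sub>1 z\<^sub>2 \<longleftrightarrow> selfadjoint star z\<^sub>1 \<and> selfadjoint star z\<^sub>2 \<and> z\<^sub>2 - z\<^sub>1 \<in> pos"

locale ordered_star_space = vector_space scaleZ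
  for scaleZ :: "complex \<Rightarrow> 'z::ab_group_add \<Rightarrow> 'z" +
  fixes star :: "'z \<Rightarrow> 'z"
    and pos :: "'z set"
  assumes star_add: "star (x + y) = star x + star y"
    and star_scale: "star (scaleZ a x) = scaleZ (cnj a) (star x)"
    and star_star: "star (star x) = x"
    and pos_comb: "\<lbrakk>x \<in> pos; y \<in> pos; 0 \<le> a; 0 \<le> b\<rbrakk>
          \<Longrightarrow> scaleZ (complex_of_real a) x + scaleZ (complex_of_real b) y \<in> pos"
    and pos_strict: "pos \<inter> uminus ` pos = {0}"
    and pos_selfadjoint: "x \<in> pos \<Longrightarrow> selfadjoint star x"

definition seminorm :: "(complex \<Rightarrow> 'a::ab_group_add \<Rightarrow> 'a) \<Rightarrow> ('a \<Rightarrow> real) \<Rightarrow> bool" where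
  "seminorm scaleV p \<longleftrightarrow>
     (\<forall>x. 0 \<le> p x) \<and> (\<forall>x y. p (x + y) \<le> p x + p y) \<and> (\<forall>a x. p (scaleV a x) = cmod a * p x)"

definition increasing :: "('z::ab_group_add \<Rightarrow> 'z) \<Rightarrow> 'z set \<Rightarrow> ('z \<Rightarrow> real) \<Rightarrow> bool" where
  "increasing star pos p \<longleftrightarrow>
     (\<forall>x y. star_le star pos 0 x \<and> star_le star pos x y \<longrightarrow> p x \<le> p y)"

definition absolutely_convex :: "(complex \<Rightarrow> 'a::ab_group_add \<Rightarrow> 'a) \<Rightarrow> 'a set \<Rightarrow> bool" where
  "absolutely_convex scaleV C \<longleftrightarrow>
     (\<forall>x\<in>C. \<forall>y\<in>C. \<forall>a b. cmod a + cmod b \<le> 1 \<longrightarrow> scaleV a x + scaleV b y \<in> C)"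

definition solid :: "('z::ab_group_add \<Rightarrow> 'z) \<Rightarrow> 'z set \<Rightarrow> 'z set \<Rightarrow> bool" where
  "solid star pos C \<longleftrightarrow>
     (\<forall>x\<in>C. \<forall>y. star_le star pos 0 y \<and> star_le star pos y x \<longrightarrow> y \<in> C)"

definition neighbourhood_of_origin :: "'a::zero topology \<Rightarrow> 'a set \<Rightarrow> bool" where
  "neighbourhood_of_origin T C \<longleftrightarrow> (\<exists>U. openin T U \<and> 0 \<in> U \<and> U \<subseteq> C)"

text \<open>
  That the (translation invariant) topology is generated by the absolutely convex solid
  neighbourhoods of the origin is expressed by saying that they form a neighbourhood base at the
  origin; absolute convexity and solidity are preserved by finite intersections and positive
  multiples, so it does not matter whether one reads ``generated'' in the sense of a base or of a
  subbase.  Local convexity is part of \<open>solid_base\<close>.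
\<close>

locale topologically_ordered_star_space = ordered_star_space scaleZ star pos
  for scaleZ :: "complex \<Rightarrow> 'z::ab_group_add \<Rightarrow> 'z"
    and star :: "'z \<Rightarrow> 'z"
    and pos :: "'z set" +
  fixes T :: "'z topology"
  assumes topspace_T: "topspace T = UNIV"
    and Hausdorff_T: "Hausdorff_space T"
    and continuous_add: "continuous_map (prod_topology T T) T (\<lambda>(x, y). x + y)"
    and continuous_scale: "continuous_map (prod_topology euclidean T) T (\<lambda>(a, x). scaleZ a x)"
    and solid_base: "\<lbrakk>openin T U; 0 \<in> U\<rbrakk>
          \<Longrightarrow> \<exists>C. neighbourhood_of_origin T C \<and> absolutely_convex scaleZ C \<and> solid star pos C
                \<and> C \<subseteq> U"

text \<open>The set $S(Z)$.\<close>

definition increasing_seminorms ::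
  "(complex \<Rightarrow> 'z::ab_group_add \<Rightarrow> 'z) \<Rightarrow> ('z \<Rightarrow> 'z) \<Rightarrow> 'z set \<Rightarrow> 'z topology \<Rightarrow> ('z \<Rightarrow> real) set"
where
  "increasing_seminorms scaleZ star pos T =
     {p. seminorm scaleZ p \<and> increasing star pos p \<and> continuous_map T euclideanreal p}"

locale VE_space = ordered_star_space scaleZ star pos + H: vector_space scaleH
  for scaleZ :: "complex \<Rightarrow> 'z::ab_group_add \<Rightarrow> 'z"
    and star :: "'z \<Rightarrow> 'z"
    and pos :: "'z set"
    and scaleH :: "complex \<Rightarrow> 'h::ab_group_add \<Rightarrow> 'h" +
  fixes gram :: "'h \<Rightarrow> 'h \<Rightarrow> 'z"
  assumes gram_linear: "Vector_Spaces.linear scaleH scaleZ (gram x)"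
    and gram_star: "gram x y = star (gram y x)"
    and gram_pos: "star_le star pos 0 (gram x x)"
    and gram_definite: "gram x x = 0 \<longleftrightarrow> x = 0"

text \<open>
  The topology of a topological VE-space is determined by the other data (see \<open>VE_topology\<close>
  below), so it is not an additional parameter.
\<close>

locale topological_VE_space =
  VE_space scaleZ star pos scaleH gram + topologically_ordered_star_space scaleZ star pos T
  for scaleZ :: "complex \<Rightarrow> 'z::ab_group_add \<Rightarrow> 'z"
    and star :: "'z \<Rightarrow> 'z"
    and pos :: "'z set"
    and T :: "'z topology"
    and scaleH :: "complex \<Rightarrow> 'h::ab_group_add \<Rightarrow> 'h"
    and gram :: "'h \<Rightarrow> 'h \<Rightarrow> 'z"

definition VE_seminorm :: "('h \<Rightarrow> 'h \<Rightarrow> 'z) \<Rightarrow> ('z \<Rightarrow> real) \<Rightarrow> 'h \<Rightarrow> real" where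
  "VE_seminorm gram p h = sqrt (p (gram h h))"

definition VE_topology ::
  "(complex \<Rightarrow> 'z::ab_group_add \<Rightarrow> 'z) \<Rightarrow> ('z \<Rightarrow> 'z) \<Rightarrow> 'z set \<Rightarrow> 'z topology
     \<Rightarrow> ('h::ab_group_add \<Rightarrow> 'h \<Rightarrow> 'z) \<Rightarrow> 'h topology"
where
  "VE_topology scaleZ star pos T gram =
     topology_generated_by
       {{h. VE_seminorm gram p (h - h\<^sub>0) < e} | p h\<^sub>0 e.
          p \<in> increasing_seminorms scaleZ star pos T \<and> 0 < e}"

definition adjointable_operators ::
  "(complex \<Rightarrow> 'h::ab_group_add \<Rightarrow> 'h) \<Rightarrow> ('h \<Rightarrow> 'h \<Rightarrow> 'z) \<Rightarrow> ('h \<Rightarrow> 'h) set"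
where
  "adjointable_operators scaleH gram =
     {A. Vector_Spaces.linear scaleH scaleH A \<and>
         (\<exists>B. Vector_Spaces.linear scaleH scaleH B \<and> (\<forall>g h. gram (A g) h = gram g (B h)))}"

definition positive_semidefinite_kernel ::
  "('z::ab_group_add \<Rightarrow> 'z) \<Rightarrow> 'z set \<Rightarrow> ('h \<Rightarrow> 'h \<Rightarrow> 'z) \<Rightarrow> 'x set \<Rightarrow> ('x \<Rightarrow> 'x \<Rightarrow> 'h \<Rightarrow> 'h) \<Rightarrow> bool"
where
  "positive_semidefinite_kernel star pos gram X k \<longleftrightarrow>
     (\<forall>(n::nat) x h. (\<forall>i\<in>{1..n}. x i \<in> X) \<longrightarrow>
        star_le star pos 0 (\<Sum>i=1..n. \<Sum>j=1..n. gram (k (x i) (x j) (h j)) (h i)))"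

text \<open>
  The estimate is required for \<open>n \<ge> 1\<close> only.  Requiring it for \<open>n = 0\<close> as well gives an
  equivalent notion, since \<open>r\<close> can be replaced by the maximum of \<open>r\<close> and \<open>VE_seminorm gram p\<close>.
\<close>

definition m_topologisable ::
  "(complex \<Rightarrow> 'z::ab_group_add \<Rightarrow> 'z) \<Rightarrow> ('z \<Rightarrow> 'z) \<Rightarrow> 'z set \<Rightarrow> 'z topology
     \<Rightarrow> (complex \<Rightarrow> 'h::ab_group_add \<Rightarrow> 'h) \<Rightarrow> ('h \<Rightarrow> 'h \<Rightarrow> 'z) \<Rightarrow> ('h \<Rightarrow> 'h) \<Rightarrow> bool"
where
  "m_topologisable scaleZ star pos T scaleH gram A \<longleftrightarrow>
     Vector_Spaces.linear scaleH scaleH A \<and>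
     (\<forall>p\<in>increasing_seminorms scaleZ star pos T.
        \<exists>D\<ge>0. \<exists>r. seminorm scaleH r \<and>
          continuous_map (VE_topology scaleZ star pos T gram) euclideanreal r \<and>
          (\<forall>n\<ge>1. \<forall>h. sqrt (p (gram ((A ^^ n) h) ((A ^^ n) h))) \<le> D ^ n * r h))"

end

theory Submission
  imports Defs
begin

text \<open>
  Put \<open>A = k x x\<close>, \<open>g = (\<Sum>i. k x (y i) (h i))\<close> and let \<open>w\<close> be the positive element
  \<open>\<Sum>i j. [k (y j) (y i) (h i), h j]\<close>, so that the claim reads \<open>p [g, g] \<le> c * p w\<close>.  The proof uses
  one principle twice: if \<open>b - 2 t a + t\<^sup>2 c\<close> is positive for every \<open>t > 0\<close>, where \<open>a\<close> is
  positive, then \<open>(p a)\<^sup>2 \<le> p b * p c\<close>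
  (\<open>increasing_seminorm_discriminant\<close>).  This is the Schwarz inequality with \<open>p\<close> applied
  to it, and monotonicity of \<open>p\<close> is what makes the constant equal to one.

  Adjoining the point \<open>x\<close> with the vector \<open>- t g\<close> to the family \<open>(y i, h i)\<close> in the
  positivity condition shows that \<open>w - 2 t [g, g] + t\<^sup>2 [A g, g]\<close> is positive, because
  \<open>k x (y i)\<close> and \<open>k (y i) x\<close> are adjoint to each other (\<open>psd_kernel_hermitian\<close>); hence
  \<open>(p [g, g])\<^sup>2 \<le> p w * p [A g, g]\<close> (\<open>kernel_schwarz\<close>).

  It remains to compare \<open>p [A g, g]\<close> with \<open>p [g, g]\<close>, which may be assumed nonzero.  Since \<open>A\<close> is symmetric,
  positivity of \<open>[A\<^sup>m g - t g, A\<^sup>m g - t g]\<close> gives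
  \<open>(p [A\<^sup>m g, g])\<^sup>2 \<le> p [g, g] * p [A\<^sup>2\<^sup>m g, g]\<close>.  Iterating over \<open>m = 1, 2, 4, 8, \<dots>\<close> bounds
  \<open>(p [A g, g] / p [g, g])\<close> to the power \<open>2\<^sup>n\<close> by \<open>p [A\<^sup>N g, g] / p [g, g]\<close> with \<open>N = 2\<^sup>n\<close>, which by
  m-topologisability grows at most like a constant times \<open>D\<^sup>N\<close>.  Taking roots makes the
  constant, which depends on \<open>g\<close>, disappear: \<open>p [A g, g] \<le> D * p [g, g]\<close>
  (\<open>power_bounded_imp_form_bounded\<close>).  Together, \<open>(p [g, g])\<^sup>2 \<le> D * p w * p [g, g]\<close>, and
  \<open>c = D\<close> works.
\<close>

section \<open>Two estimates for real numbers\<close>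

lemma discriminant_bound:
  fixes a b c :: real
  assumes "0 \<le> a" "0 \<le> b" "0 \<le> c" and quad: "\<And>t. 0 < t \<Longrightarrow> 2 * t * a \<le> b + t\<^sup>2 * c"
  shows "a\<^sup>2 \<le> b * c"
proof (cases "a = 0")
  case True
  with assms(2,3) show ?thesis by simp
next
  case False
  with assms(1) have a: "0 < a" by simp
  have "c \<noteq> 0"
  proof
    assume "c = 0"
    have "0 < (b + 1) / (2 * a)" using a assms(2) by simp
    from quad[OF this] a \<open>c = 0\<close> show False by simp
  qed
  with assms(3) have c: "0 < c" by simp
  from quad[of "a / c"] a c have "2 * (a / c) * a \<le> b + (a / c)\<^sup>2 * c" by simp
  with c show ?thesis by (simp add: field_simps power2_eq_square)
qed

text \<open>
  The exponents \<open>2 ^ n\<close> tend to infinity, so a fixed factor \<open>K\<close> cannot compensate a ratio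
  \<open>b / D > 1\<close>.
\<close>

lemma le_of_powers_le:
  fixes b D K :: real
  assumes "0 \<le> D" and le: "\<And>n::nat. b ^ (2 ^ Suc n) \<le> D ^ (2 ^ Suc n) * K"
  shows "b \<le> D"
proof (rule ccontr)
  assume "\<not> b \<le> D"
  then have "D < b" by simp
  \<comment> \<open>Replace \<open>D\<close> by a positive number still below \<open>b\<close>, to allow division.\<close>
  define E where "E = (D + b) / 2"
  have E: "0 < E" "D \<le> E" "E < b"
    using assms(1) \<open>D < b\<close> by (auto simp: E_def)
  from E have "1 < b / E" by simp
  then obtain m where m: "max K 1 < (b / E) ^ m"
    using real_arch_pow by blast
  define N where "N = (2::nat) ^ Suc m"
  have "m \<le> N" unfolding N_def
    using less_exp[of "Suc m"] by simp
  then have "(b / E) ^ m \<le> (b / E) ^ N"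
    using \<open>1 < b / E\<close> by (intro power_increasing) auto
  with m have "max K 1 < b ^ N / E ^ N"
    by (simp add: power_divide)
  then have "max K 1 * E ^ N < b ^ N"
    using E(1) by (simp only: pos_less_divide_eq zero_less_power)
  moreover have "b ^ N \<le> D ^ N * K"
    using le[of m] by (simp add: N_def)
  moreover have "D ^ N * K \<le> E ^ N * max K 1"
  proof -
    have "D ^ N * K \<le> D ^ N * max K 1"
      using assms(1) by (intro mult_left_mono) auto
    also have "\<dots> \<le> E ^ N * max K 1"
      using assms(1) E(2) by (intro mult_right_mono power_mono) auto
    finally show ?thesis .
  qed
  ultimately show False by (simp add: mult.commute)
qed

section \<open>Order and increasing seminorms\<close>

context ordered_star_space
begin

lemma star_zero: "star 0 = 0"
  using star_scale[of 0 0] by simp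

lemma star_le_zero_iff: "star_le star pos 0 z \<longleftrightarrow> z \<in> pos"
  using pos_selfadjoint[of z] by (auto simp: star_le_def selfadjoint_def star_zero)

lemma pos_add: "z \<in> pos \<Longrightarrow> w \<in> pos \<Longrightarrow> z + w \<in> pos"
  using pos_comb[of z w 1 1] by simp

lemma pos_scale: "z \<in> pos \<Longrightarrow> 0 \<le> a \<Longrightarrow> scaleZ (complex_of_real a) z \<in> pos"
  using pos_comb[of z z a 0] by simp

lemma star_pos: "z \<in> pos \<Longrightarrow> star z = z"
  using pos_selfadjoint by (simp add: selfadjoint_def)

lemma increasing_le:
  assumes "increasing star pos p" "z \<in> pos" "w - z \<in> pos"
  shows "p z \<le> p w"
proof -
  have "w \<in> pos" using pos_add[OF assms(3,2)] by simp
  then have "star_le star pos z w"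
    using assms pos_selfadjoint by (simp add: star_le_def)
  moreover have "star_le star pos 0 z"
    using assms(2) by (simp add: star_le_zero_iff)
  ultimately show ?thesis
    using assms(1) by (auto simp: increasing_def)
qed

text \<open>
  The order estimate \<open>2 t a \<le> b + t\<^sup>2 c\<close> survives the application of \<open>p\<close>, and optimising over
  \<open>t\<close> can then be done in the real numbers.
\<close>

lemma increasing_seminorm_discriminant:
  assumes p: "seminorm scaleZ p" "increasing star pos p"
    and a: "a \<in> pos"
    and quad: "\<And>t. 0 < t \<Longrightarrow> b - scaleZ (complex_of_real (2 * t)) a
                 + scaleZ (complex_of_real (t\<^sup>2)) c \<in> pos"
  shows "(p a)\<^sup>2 \<le> p b * p c"
proof (rule discriminant_bound)
  show "0 \<le> p a" "0 \<le> p b" "0 \<le> p c" using p(1) by (auto simp: seminorm_def)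
  have p_add: "p (z + w) \<le> p z + p w" and p_scale: "p (scaleZ s z) = cmod s * p z" for z w s
    using p(1) by (auto simp: seminorm_def)
  fix t :: real
  assume t: "0 < t"
  have "p (scaleZ (complex_of_real (2 * t)) a) \<le> p (b + scaleZ (complex_of_real (t\<^sup>2)) c)"
  proof (rule increasing_le[OF p(2)])
    show "scaleZ (complex_of_real (2 * t)) a \<in> pos"
      using a t by (intro pos_scale) auto
    show "b + scaleZ (complex_of_real (t\<^sup>2)) c - scaleZ (complex_of_real (2 * t)) a \<in> pos"
      using quad[OF t] by (simp add: algebra_simps)
  qed
  also have "\<dots> \<le> p b + p (scaleZ (complex_of_real (t\<^sup>2)) c)"
    by (rule p_add)
  finally show "2 * t * p a \<le> p b + t\<^sup>2 * p c"
    using t by (simp only: p_scale norm_of_real) (simp add: abs_mult)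
qed

end

section \<open>Gramians and the Schwarz inequality\<close>

context VE_space
begin

lemma gram_add_right: "gram z (v + w) = gram z v + gram z w"
  and gram_scale_right: "gram z (scaleH s v) = scaleZ s (gram z v)"
  using gram_linear[of z] by (auto simp: Vector_Spaces.linear_iff)

lemma gram_add_left: "gram (v + w) z = gram v z + gram w z"
  using gram_star[of "v + w" z] gram_star[of v z] gram_star[of w z]
  by (simp add: gram_add_right star_add)

text \<open>
  In the axiom \<open>star_scale\<close> the scalar is real, so moving a scalar through the involution gives
  homogeneity in the first variable for real scalars.
\<close>

lemma gram_scale_left:
  "gram (scaleH (complex_of_real s) v) z = scaleZ (complex_of_real s) (gram v z)"
  using gram_star[of "scaleH (complex_of_real s) v" z] gram_star[of v z]
  by (simp add: gram_scale_right star_scale)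

lemma gram_diff_right: "gram z (v - w) = gram z v - gram z w"
  using gram_add_right[of z "v - w" w] by (simp add: eq_diff_eq)

lemma gram_diff_left: "gram (v - w) z = gram v z - gram w z"
  using gram_add_left[of "v - w" w z] by (simp add: eq_diff_eq)

lemma gram_zero_right: "gram z 0 = 0"
  using gram_scale_right[of z 0 0] by simp

lemma gram_zero_left: "gram 0 z = 0"
  using gram_add_left[of 0 0 z] by simp

lemma gram_sum_right: "gram z (\<Sum>i\<in>I. f i) = (\<Sum>i\<in>I. gram z (f i))"
  by (induction I rule: infinite_finite_induct) (auto simp: gram_zero_right gram_add_right)

lemma gram_sum_left: "gram (\<Sum>i\<in>I. f i) z = (\<Sum>i\<in>I. gram (f i) z)"
  by (induction I rule: infinite_finite_induct) (auto simp: gram_zero_left gram_add_left)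

lemma gram_self_pos: "gram z z \<in> pos"
  using gram_pos star_le_zero_iff by blast

text \<open>
  The quadratic expression is \<open>[v - t g, v - t g]\<close>, whose two mixed terms coincide since the
  positive element \<open>[v, g]\<close> is selfadjoint.  General elements \<open>[v, g]\<close> are not comparable with \<open>0\<close>,
  and then monotonicity of \<open>p\<close> says nothing about them.
\<close>

lemma increasing_seminorm_schwarz:
  assumes p: "seminorm scaleZ p" "increasing star pos p" and vg: "gram v g \<in> pos"
  shows "(p (gram v g))\<^sup>2 \<le> p (gram v v) * p (gram g g)"
proof (rule increasing_seminorm_discriminant[OF p vg])
  fix t :: real
  have gv: "gram g v = gram v g"
    using gram_star[of g v] star_pos[OF vg] by simp
  have "gram (v - scaleH (complex_of_real t) g) (v - scaleH (complex_of_real t) g)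
      = gram v v - scaleZ (complex_of_real (2 * t)) (gram v g)
          + scaleZ (complex_of_real (t\<^sup>2)) (gram g g)"
    using scale_left_distrib[of "complex_of_real t" "complex_of_real t" "gram v g"]
    by (simp add: gram_diff_left gram_diff_right gram_scale_left gram_scale_right gv
        power2_eq_square algebra_simps)
  then show "gram v v - scaleZ (complex_of_real (2 * t)) (gram v g)
      + scaleZ (complex_of_real (t\<^sup>2)) (gram g g) \<in> pos"
    using gram_self_pos[of "v - scaleH (complex_of_real t) g"] by (simp only:)
qed

section \<open>Form bounds from the growth of iterates\<close>

text \<open>
  Repeated squaring of the Schwarz inequality bounds the \<open>2\<^sup>n\<close>-th power of
  \<open>p [A g, g] / p [g, g]\<close> by that of \<open>D\<close> times a multiple of \<open>R\<^sup>2\<close>.  The contribution of \<open>R\<close>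
  disappears when roots are taken, so \<open>R\<close> may depend on \<open>g\<close> in an arbitrary way.
\<close>

lemma power_bounded_imp_form_bounded:
  assumes p: "seminorm scaleZ p" "increasing star pos p"
    and sym: "\<And>v w. gram (A v) w = gram v (A w)"
    and form_pos: "gram (A g) g \<in> pos"
    and "0 \<le> D"
    and growth: "\<And>n. 1 \<le> n \<Longrightarrow> sqrt (p (gram ((A ^^ n) g) ((A ^^ n) g))) \<le> D ^ n * R"
  shows "p (gram (A g) g) \<le> D * p (gram g g)"
proof -
  define u where "u n = p (gram ((A ^^ n) g) g)" for n
  have p_nonneg: "0 \<le> p z" for z
    using p(1) by (auto simp: seminorm_def)
  have sym_pow: "gram ((A ^^ n) v) w = gram v ((A ^^ n) w)" for n v w
    by (induction n arbitrary: v) (auto simp: sym funpow_swap1)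
  have even: "gram ((A ^^ (m + m)) g) g = gram ((A ^^ m) g) ((A ^^ m) g)" for m
    by (simp add: funpow_add sym_pow)
  \<comment> \<open>Schwarz between \<open>A\<^sup>m g\<close> and \<open>g\<close>; the square of the former is again a value of the form.\<close>
  have double: "(u m)\<^sup>2 \<le> u (m + m) * u 0" if "gram ((A ^^ m) g) g \<in> pos" for m
    using increasing_seminorm_schwarz[OF p that] by (simp add: u_def even)
  have iter_pos: "gram ((A ^^ (2 ^ n)) g) g \<in> pos" for n
  proof (cases n)
    case (Suc m)
    have "gram ((A ^^ (2 ^ n)) g) g = gram ((A ^^ (2 ^ m)) g) ((A ^^ (2 ^ m)) g)"
      using even[of "2 ^ m"] by (simp add: Suc mult_2)
    then show ?thesis by (simp add: gram_self_pos)
  qed (use form_pos in simp)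
  have step: "(u (2 ^ n))\<^sup>2 \<le> u (2 ^ Suc n) * u 0" for n
    using double[OF iter_pos, of n] by (simp add: mult_2)
  show ?thesis
  proof (cases "u 0 = 0")
    case True
    with step[of 0] show ?thesis by (simp add: u_def)
  next
    case False
    then have u0: "0 < u 0" using p_nonneg by (simp add: u_def less_le)
    define b where "b = u 1 / u 0"
    have "0 \<le> b" by (simp add: b_def u_def p_nonneg)
    have pow_le: "b ^ (2 ^ n) \<le> u (2 ^ n) / u 0" for n
    proof (induction n)
      case 0
      then show ?case by (simp add: b_def)
    next
      case (Suc n)
      have "b ^ (2 ^ Suc n) = (b ^ (2 ^ n))\<^sup>2"
        by (simp add: power_mult[symmetric] mult.commute)
      also have "\<dots> \<le> (u (2 ^ n) / u 0)\<^sup>2"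
        using Suc \<open>0 \<le> b\<close> by (intro power_mono) auto
      also have "\<dots> \<le> u (2 ^ Suc n) * u 0 / (u 0)\<^sup>2"
        using step[of n] by (simp add: power_divide divide_right_mono)
      also have "\<dots> = u (2 ^ Suc n) / u 0"
        using u0 by (simp add: power2_eq_square)
      finally show ?case .
    qed
    have "b \<le> D"
    proof (rule le_of_powers_le[OF \<open>0 \<le> D\<close>])
      fix n :: nat
      have "u (2 ^ Suc n) = (sqrt (p (gram ((A ^^ 2 ^ n) g) ((A ^^ 2 ^ n) g))))\<^sup>2"
        using even[of "2 ^ n"] by (simp add: u_def mult_2 p_nonneg)
      also have "\<dots> \<le> (D ^ (2 ^ n) * R)\<^sup>2"
        using growth[of "2 ^ n"] by (intro power_mono) (auto simp: p_nonneg)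
      also have "\<dots> = D ^ (2 ^ Suc n) * R\<^sup>2"
        by (simp add: power_mult_distrib power_mult[symmetric] mult.commute)
      finally have "u (2 ^ Suc n) / u 0 \<le> D ^ (2 ^ Suc n) * R\<^sup>2 / u 0"
        using u0 by (simp add: divide_right_mono)
      with pow_le[of "Suc n"] show "b ^ (2 ^ Suc n) \<le> D ^ (2 ^ Suc n) * (R\<^sup>2 / u 0)"
        by simp
    qed
    with u0 show ?thesis by (simp add: b_def u_def field_simps)
  qed
qed

section \<open>Positive semidefinite kernels\<close>

lemma psd_kernel_sum_pos:
  fixes n :: nat
  assumes "positive_semidefinite_kernel star pos gram X k"
    and "\<And>i. i \<in> {1..n} \<Longrightarrow> y i \<in> X"
  shows "(\<Sum>i=1..n. \<Sum>j=1..n. gram (k (y i) (y j) (h j)) (h i)) \<in> pos"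
  using assms unfolding positive_semidefinite_kernel_def star_le_zero_iff by blast

lemma psd_kernel_diagonal_pos:
  assumes "positive_semidefinite_kernel star pos gram X k" "u \<in> X"
  shows "gram (k u u f) f \<in> pos"
  using psd_kernel_sum_pos[OF assms(1), of 1 "\<lambda>_. u" "\<lambda>_. f"] assms(2) by simp

text \<open>
  The hypothesis says that the gramian of any vector with \<open>v\<close> or with \<open>\<i> v\<close> is selfadjoint.  Then
  \<open>[\<i> v, \<i> v] = \<i> [\<i> v, v] = \<i> [v, \<i> v] = - [v, v]\<close>, and \<open>[v, v] = 0\<close> because
  the cone is strict.
\<close>

lemma eq_zero_if_gram_symmetric:
  assumes v: "\<And>h. gram h v = gram v h"
    and iv: "\<And>h. gram h (scaleH \<i> v) = gram (scaleH \<i> v) h"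
  shows "v = 0"
proof -
  have "gram (scaleH \<i> v) (scaleH \<i> v) = scaleZ \<i> (gram v (scaleH \<i> v))"
    by (simp only: gram_scale_right iv[of v, symmetric])
  also have "\<dots> = - gram v v"
    by (simp add: gram_scale_right)
  finally have "- gram v v \<in> pos"
    using gram_self_pos[of "scaleH \<i> v"] by simp
  then have "gram v v \<in> pos \<inter> uminus ` pos"
    using gram_self_pos[of v] by (auto intro: image_eqI[of _ _ "- gram v v"])
  then show ?thesis
    by (simp add: pos_strict gram_definite)
qed

text \<open>
  A positive semidefinite kernel is hermitian: at two points, the mixed terms of the positivity
  condition have a selfadjoint sum.  In terms of the adjoint \<open>B\<close> of \<open>k u v\<close> this says that
  \<open>[h, B f - k v u f]\<close> is selfadjoint for all \<open>h\<close> and \<open>f\<close>, also with \<open>\<i> f\<close> in place of \<open>f\<close>, and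
  \<open>eq_zero_if_gram_symmetric\<close> gives \<open>B f = k v u f\<close>.  Going through \<open>B\<close> confines the
  scalar \<open>\<i>\<close> to the second variable of the gramian, where linearity is complex.  For \<open>u = v\<close> the lemma is
  the symmetry of the diagonal operators.
\<close>

lemma psd_kernel_hermitian:
  assumes psd: "positive_semidefinite_kernel star pos gram X k"
    and adj: "\<And>u v. u \<in> X \<Longrightarrow> v \<in> X \<Longrightarrow> k u v \<in> adjointable_operators scaleH gram"
    and uv: "u \<in> X" "v \<in> X"
  shows "gram (k u v h) f = gram h (k v u f)"
proof -
  obtain B where B_scale: "\<And>c f. B (scaleH c f) = scaleH c (B f)"
    and B: "\<And>g h. gram (k u v g) h = gram g (B h)"
    using adj[OF uv] by (auto simp: adjointable_operators_def Vector_Spaces.linear_iff)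
  have k_scale: "k v u (scaleH c f) = scaleH c (k v u f)" for c f
    using adj[OF uv(2,1)] by (auto simp: adjointable_operators_def Vector_Spaces.linear_iff)
  have sym: "gram h (B f - k v u f) = gram (B f - k v u f) h" for h f
  proof -
    let ?d = "gram (k u u f) f + gram (k v v h) h"
    let ?m = "gram (k u v h) f + gram (k v u f) h"
    have "(\<Sum>i=1..(2::nat). \<Sum>j=1..(2::nat). gram (k (if i = 1 then u else v)
        (if j = 1 then u else v) (if j = 1 then f else h)) (if i = 1 then f else h)) \<in> pos"
      by (rule psd_kernel_sum_pos[OF psd, where y = "\<lambda>i. if i = 1 then u else v"]) (use uv in auto)
    then have "?d + ?m \<in> pos"
      by (simp add: numeral_2_eq_2 algebra_simps)
    moreover have "?d \<in> pos"
      by (intro pos_add psd_kernel_diagonal_pos[OF psd] uv)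
    ultimately have "star (?d + ?m) = ?d + ?m" "star ?d = ?d"
      by (simp_all only: star_pos)
    then have "star ?m = ?m"
      by (simp only: star_add[of ?d] add_left_cancel)
    then have "gram (B f) h + gram h (k v u f) = gram h (B f) + gram (k v u f) h"
      using gram_star[of "B f" h] gram_star[of h "k v u f"] by (simp only: star_add B)
    then show ?thesis
      by (simp add: gram_diff_left gram_diff_right algebra_simps)
  qed
  have "B f - k v u f = 0"
  proof (rule eq_zero_if_gram_symmetric)
    show "gram h (scaleH \<i> (B f - k v u f)) = gram (scaleH \<i> (B f - k v u f)) h" for h
      using sym[of h "scaleH \<i> f"] by (simp only: B_scale k_scale H.scale_right_diff_distrib)
  qed (rule sym)
  then show ?thesis by (simp add: B)
qed

text \<open>
  The Schwarz inequality for the semi-inner product that \<open>k\<close> induces on finite families of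
  (point, vector) pairs, taken between the family \<open>(y i, h i)\<close> and the single pair \<open>(x, g)\<close>.
  The vector \<open>g\<close> is chosen so that their mixed product is \<open>[g, g]\<close>, which is positive, as the
  passage to \<open>p\<close> requires.
\<close>

lemma kernel_schwarz:
  fixes h :: "nat \<Rightarrow> 'h"
  assumes psd: "positive_semidefinite_kernel star pos gram X k"
    and adj: "\<And>u v. u \<in> X \<Longrightarrow> v \<in> X \<Longrightarrow> k u v \<in> adjointable_operators scaleH gram"
    and p: "seminorm scaleZ p" "increasing star pos p"
    and x: "x \<in> X"
    and y: "\<And>i. i \<in> {1..n} \<Longrightarrow> y i \<in> X"
  defines "g \<equiv> \<Sum>i=1..n. k x (y i) (h i)"
  shows "(p (gram g g))\<^sup>2
    \<le> p (\<Sum>i=1..n. \<Sum>j=1..n. gram (k (y i) (y j) (h j)) (h i)) * p (gram (k x x g) g)"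
proof (rule increasing_seminorm_discriminant[OF p gram_self_pos])
  let ?w = "\<Sum>i=1..n. \<Sum>j=1..n. gram (k (y i) (y j) (h j)) (h i)"
  fix t :: real
  define s where "s = complex_of_real (- t)"
  \<comment> \<open>The pair \<open>(x, - t g)\<close> goes to the end of the family.\<close>
  define Y where "Y i = (if i = Suc n then x else y i)" for i
  define H where "H i = (if i = Suc n then scaleH s g else h i)" for i
  have k_scale: "k u v (scaleH c z) = scaleH c (k u v z)" if "u \<in> X" "v \<in> X" for u v c z
    using adj[OF that] by (simp add: adjointable_operators_def Vector_Spaces.linear_iff)
  have row: "(\<Sum>j=1..n. gram (k x (y j) (h j)) (scaleH s g)) = scaleZ s (gram g g)"
    by (simp only: gram_scale_right scale_sum_right[symmetric] gram_sum_left[symmetric]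
        g_def[symmetric])
  have "gram (k (y i) x (scaleH s g)) (h i) = scaleZ s (gram g (k x (y i) (h i)))"
    if "i \<in> {1..n}" for i
    using psd_kernel_hermitian[OF psd adj y[OF that] x, of "scaleH s g" "h i"]
    by (simp only: gram_scale_left s_def)
  then have "(\<Sum>i=1..n. gram (k (y i) x (scaleH s g)) (h i))
      = (\<Sum>i=1..n. scaleZ s (gram g (k x (y i) (h i))))"
    by (rule sum.cong[OF refl])
  then have col: "(\<Sum>i=1..n. gram (k (y i) x (scaleH s g)) (h i)) = scaleZ s (gram g g)"
    by (simp only: scale_sum_right[symmetric] gram_sum_right[symmetric] g_def[symmetric])
  have corner: "gram (k x x (scaleH s g)) (scaleH s g)
      = scaleZ (complex_of_real (t\<^sup>2)) (gram (k x x g) g)"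
    unfolding k_scale[OF x x] s_def gram_scale_left gram_scale_right
    by (simp add: power2_eq_square)
  have "(\<Sum>i=1..Suc n. \<Sum>j=1..Suc n. gram (k (Y i) (Y j) (H j)) (H i)) \<in> pos"
    by (rule psd_kernel_sum_pos[OF psd]) (use x y in \<open>auto simp: Y_def\<close>)
  also have "(\<Sum>i=1..Suc n. \<Sum>j=1..Suc n. gram (k (Y i) (Y j) (H j)) (H i))
      = ?w + (\<Sum>i=1..n. gram (k (y i) x (scaleH s g)) (h i))
        + (\<Sum>j=1..n. gram (k x (y j) (h j)) (scaleH s g))
        + gram (k x x (scaleH s g)) (scaleH s g)"
    by (simp add: Y_def H_def sum.distrib algebra_simps)
  also have "\<dots> = ?w - scaleZ (complex_of_real (2 * t)) (gram g g)
      + scaleZ (complex_of_real (t\<^sup>2)) (gram (k x x g) g)"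
    using scale_left_distrib[of "complex_of_real t" "complex_of_real t" "gram g g"]
    unfolding row col corner by (simp add: s_def)
  finally show "?w - scaleZ (complex_of_real (2 * t)) (gram g g)
      + scaleZ (complex_of_real (t\<^sup>2)) (gram (k x x g) g) \<in> pos" .
qed

end

theorem proposition2p17:
  fixes scaleZ :: "complex \<Rightarrow> 'z::ab_group_add \<Rightarrow> 'z"
    and star :: "'z \<Rightarrow> 'z"
    and pos :: "'z set"
    and T :: "'z topology"
    and scaleH :: "complex \<Rightarrow> 'h::ab_group_add \<Rightarrow> 'h"
    and gram :: "'h \<Rightarrow> 'h \<Rightarrow> 'z"
    and X :: "'x set"
    and k :: "'x \<Rightarrow> 'x \<Rightarrow> 'h \<Rightarrow> 'h"
    and x :: 'x
    and p :: "'z \<Rightarrow> real"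
  assumes "topological_VE_space scaleZ star pos T scaleH gram"
    and "X \<noteq> {}"
    and "\<And>u v. u \<in> X \<Longrightarrow> v \<in> X \<Longrightarrow> k u v \<in> adjointable_operators scaleH gram"
    and "positive_semidefinite_kernel star pos gram X k"
    and "\<And>u. u \<in> X \<Longrightarrow> m_topologisable scaleZ star pos T scaleH gram (k u u)"
    and "x \<in> X"
    and "p \<in> increasing_seminorms scaleZ star pos T"
  shows "\<exists>c\<ge>0. \<forall>(n::nat) y h. (\<forall>i\<in>{1..n}. y i \<in> X) \<longrightarrow>
           p (\<Sum>i=1..n. \<Sum>j=1..n. gram (k x (y i) (h i)) (k x (y j) (h j)))
             \<le> c * p (\<Sum>i=1..n. \<Sum>j=1..n. gram (k (y j) (y i) (h i)) (h j))"
proof -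
  interpret topological_VE_space scaleZ star pos T scaleH gram by fact
  have p: "seminorm scaleZ p" "increasing star pos p"
    using assms(7) by (auto simp: increasing_seminorms_def)
  obtain D r where D: "0 \<le> D"
    and growth: "\<And>n h. 1 \<le> n \<Longrightarrow>
      sqrt (p (gram ((k x x ^^ n) h) ((k x x ^^ n) h))) \<le> D ^ n * r h"
    using assms(5)[OF assms(6)] assms(7) unfolding m_topologisable_def by blast
  show ?thesis
  proof (intro exI[of _ D] conjI allI impI D)
    fix n :: nat and y :: "nat \<Rightarrow> 'x" and h :: "nat \<Rightarrow> 'h"
    assume "\<forall>i\<in>{1..n}. y i \<in> X"
    then have y: "\<And>i. i \<in> {1..n} \<Longrightarrow> y i \<in> X" by blast
    define g where "g = (\<Sum>i=1..n. k x (y i) (h i))"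
    define w where "w = (\<Sum>i=1..n. \<Sum>j=1..n. gram (k (y j) (y i) (h i)) (h j))"
    have w: "w = (\<Sum>i=1..n. \<Sum>j=1..n. gram (k (y i) (y j) (h j)) (h i))"
      unfolding w_def by (rule sum.swap)
    have g: "(\<Sum>i=1..n. \<Sum>j=1..n. gram (k x (y i) (h i)) (k x (y j) (h j))) = gram g g"
      unfolding g_def gram_sum_left by (simp only: gram_sum_right)
    have nonneg: "0 \<le> p z" for z
      using p(1) by (auto simp: seminorm_def)
    have "(p (gram g g))\<^sup>2 \<le> p w * p (gram (k x x g) g)"
      unfolding w g_def by (rule kernel_schwarz[OF assms(4,3) p assms(6) y])
    also have "\<dots> \<le> p w * (D * p (gram g g))"
    proof (intro mult_left_mono nonneg power_bounded_imp_form_bounded[OF p _ _ D])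
      show "gram (k x x v) z = gram v (k x x z)" for v z
        by (rule psd_kernel_hermitian[OF assms(4,3) assms(6,6)])
      show "gram (k x x g) g \<in> pos"
        by (rule psd_kernel_diagonal_pos[OF assms(4,6)])
    qed (rule growth)
    finally have "p (gram g g) * p (gram g g) \<le> D * p w * p (gram g g)"
      by (simp add: power2_eq_square mult_ac)
    then have "p (gram g g) \<le> D * p w"
      using nonneg[of "gram g g"] nonneg[of w] D
      by (cases "p (gram g g) = 0") auto
    then show "p (\<Sum>i=1..n. \<Sum>j=1..n. gram (k x (y i) (h i)) (k x (y j) (h j)))
        \<le> D * p (\<Sum>i=1..n. \<Sum>j=1..n. gram (k (y j) (y i) (h i)) (h j))"
      by (simp only: g w_def)
  qed
qed

end
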